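(* Let $d\ge 1$, $b>0$, $\mathcal{X}=[0,b]^d$, $c\in\mathcal{X}$, let $f$ be a (continuously differentiable) probability density on $\mathcal{X}$, and let $\pi(c,\cdot):\mathcal{X}\to\mathcal{X}$ be a differentiable update function with $\pi(c,c)=c$. Let $\mu$ be the signed measure on $\mathcal{X}$ defined for Borel $A\subseteq\mathcal{X}$ by $$\mu(A)=\int_{\partial\mathcal{X}}\mathbb{I}_A(x)\,f(x)\,(x-\pi(c,x))\cdot\hat n(x)\,dx-\int_{\mathcal{X}}\mathbb{I}_A(x)\Big(\nabla f(x)\cdot(x-\pi(c,x))+\big(d+1-\operatorname{div}_x\pi(c,x)\big)f(x)\Big)dx+\mathbb{I}_A(c),$$ where $\hat n$ is the outward unit normal and the first integral is with respect to surface measure on $\partial\mathcal{X}$, and let $\mu=\mu^+-\mu^-$ be its Jordan decomposition. Then $$\sup_{u\in\mathcal{U}}\Big(\int u\,d\mu^+-\int u\,d\mu^-\Big)=\inf_{\gamma:\ \gamma_1\succeq\mu^+,\ \gamma_2\preceq\mu^-}\int_{\mathcal{X}\times\mathcal{X}}\lVert x-y\rVert_1\,d\gamma(x,y),$$ where the infimum ranges over nonnegative Radon measures $\gamma$ on $\mathcal{X}\times\mathcal{X}$ with first and second marginals $\gamma_1,\gamma_2$.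
   Context: $\mathcal{U}$ is the set of functions $u:\mathcal{X}\to\mathbb{R}_{\ge 0}$ that are convex, satisfy $\lVert\nabla u(x)\rVert_\infty\le 1$ wherever the gradient exists (equivalently, $u$ is 1-Lipschitz with respect to the $\ell_1$ norm), and satisfy $u(c)=0$. For measures $\alpha,\beta$ on $\mathcal{X}$, $\alpha\succeq\beta$ (equivalently $\beta\preceq\alpha$) means $\int g\,d\alpha\ge\int g\,d\beta$ for every $g\in\mathcal{U}$. The number of goods $d$ enters $\mu$ through the coefficient $d+1$. *)

theory Defs
  imports "HOL-Analysis.Analysis"
begin

definition cube :: "real \<Rightarrow> (real^'n) set" where
  "cube b = cbox 0 (\<chi> i. b)"

definition l1norm :: "real^'n \<Rightarrow> real" where
  "l1norm x = (\<Sum>i\<in>UNIV. \<bar>x $ i\<bar>)"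

text \<open>(d-1)-dimensional surface (Lebesgue) measure on the face {x in X. x_i = s} of the cube:
  push-forward of (1/b) times Lebesgue measure on X under the projection setting coordinate i to s.
  (For d = 1 this is the unit point mass at s, i.e. 0-dimensional Hausdorff measure.)\<close>
definition face_measure :: "real \<Rightarrow> 'n \<Rightarrow> real \<Rightarrow> (real^'n) measure" where
  "face_measure b i s =
     distr (density (lebesgue_on (cube b)) (\<lambda>_. ennreal (1 / b))) borel
           (\<lambda>y. \<chi> j. if j = i then s else y $ j)"

text \<open>Outward flux of a vector field F through the boundary of the cube:
  integral over the boundary (surface measure) of F(x) dot outward unit normal, computed face by face
  (normal +e_i on the face x_i = b, -e_i on the face x_i = 0; overlaps are null sets).\<close>
definition outward_flux :: "real \<Rightarrow> (real^'n \<Rightarrow> real^'n) \<Rightarrow> real" where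
  "outward_flux b F =
     (\<Sum>i\<in>UNIV. (\<integral>x. F x $ i \<partial>face_measure b i b) - (\<integral>x. F x $ i \<partial>face_measure b i 0))"

definition divergence :: "(real^'n \<Rightarrow> real^'n \<Rightarrow> real^'n) \<Rightarrow> real^'n \<Rightarrow> real" where
  "divergence Dp x = (\<Sum>i\<in>UNIV. Dp x (axis i 1) $ i)"

definition mu_set ::
  "real \<Rightarrow> real^'n \<Rightarrow> (real^'n \<Rightarrow> real) \<Rightarrow> (real^'n \<Rightarrow> real^'n) \<Rightarrow> (real^'n \<Rightarrow> real^'n)
     \<Rightarrow> (real^'n \<Rightarrow> real^'n \<Rightarrow> real^'n) \<Rightarrow> (real^'n) set \<Rightarrow> real" where
  "mu_set b c f gradf p Dp A =
     outward_flux b (\<lambda>x. (indicator A x * f x) *\<^sub>R (x - p x))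
     - (\<integral>x. indicator A x * (gradf x \<bullet> (x - p x) + (real CARD('n) + 1 - divergence Dp x) * f x)
          \<partial>lebesgue_on (cube b))
     + indicator A c"

definition jordan_decomposition ::
  "(real^'n) set \<Rightarrow> ((real^'n) set \<Rightarrow> real) \<Rightarrow> (real^'n) measure \<Rightarrow> (real^'n) measure \<Rightarrow> bool" where
  "jordan_decomposition X nu mp mm \<longleftrightarrow>
     sets mp = sets (restrict_space borel X) \<and> sets mm = sets (restrict_space borel X) \<and>
     finite_measure mp \<and> finite_measure mm \<and>
     (\<forall>A\<in>sets (restrict_space borel X). measure mp A - measure mm A = nu A) \<and>
     (\<exists>P\<in>sets (restrict_space borel X). emeasure mm P = 0 \<and> emeasure mp (X - P) = 0)"

definition U_class :: "real \<Rightarrow> real^'n \<Rightarrow> (real^'n \<Rightarrow> real) set" where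
  "U_class b c = {u. (\<forall>x\<in>cube b. 0 \<le> u x) \<and> convex_on (cube b) u \<and>
                     (\<forall>x\<in>cube b. \<forall>y\<in>cube b. \<bar>u x - u y\<bar> \<le> l1norm (x - y)) \<and> u c = 0}"

definition dominates :: "real \<Rightarrow> real^'n \<Rightarrow> (real^'n) measure \<Rightarrow> (real^'n) measure \<Rightarrow> bool" where
  "dominates b c \<alpha> \<beta> \<longleftrightarrow> (\<forall>g\<in>U_class b c. (\<integral>x. g x \<partial>\<beta>) \<le> (\<integral>x. g x \<partial>\<alpha>))"

text \<open>Nonnegative Radon measures on X \<times> X (X compact: finite Borel measures).\<close>
definition radon_on_square :: "real \<Rightarrow> ((real^'n) \<times> (real^'n)) measure set" where
  "radon_on_square b = {\<gamma>. sets \<gamma> = sets (restrict_space borel (cube b \<times> cube b)) \<and> finite_measure \<gamma>}"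

definition marginal1 :: "real \<Rightarrow> ((real^'n) \<times> (real^'n)) measure \<Rightarrow> (real^'n) measure" where
  "marginal1 b \<gamma> = distr \<gamma> (restrict_space borel (cube b)) fst"

definition marginal2 :: "real \<Rightarrow> ((real^'n) \<times> (real^'n)) measure \<Rightarrow> (real^'n) measure" where
  "marginal2 b \<gamma> = distr \<gamma> (restrict_space borel (cube b)) snd"

end

(*
  If g and h are nonnegative convex functions vanishing at c with g(x) - h(y) <= |x - y|_1, then
  the inf-convolution of h with the norm lies in U between g and h; so a single u suffices on the
  dual side, and on the primal side it is enough to move mp to measures gamma_2 below mm.
  Rounding x to a finite grid T, such a gamma is the push-forward of mp under x |-> (x, z (T x)),
  where z k is the barycentre of a piece w k * mm of mm, the missing mass being put at c at no
  cost because every u in U vanishes there. Jensen's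
  inequality gives gamma_2 <= mm. The weights w exist by a theorem of the alternative for finitely
  many convex functions: otherwise the multipliers of the l1 cost and of the capacity constraints
  are slopes q k and offsets s k, and u y = max(0, max_k (q k . (y - c) - s k)) in U beats the
  supremum.
*)
theory Submission
  imports Defs
begin

section \<open>A theorem of the alternative and a weighted Jensen inequality\<close>

text \<open>The pairs lying componentwise above some \<open>(f x, g x)\<close> form a convex set,
  although the image of \<open>A\<close> itself need not be convex. By \<open>no\<close> this set
  misses the open negative quadrant, and the normal of a separating line, scaled to sum 1, is the
  pair of multipliers.\<close>

lemma convexlike_alternative_two:
  fixes f g :: "'a \<Rightarrow> real"
  assumes cl: "\<And>x y t. \<lbrakk>x \<in> A; y \<in> A; 0 \<le> t; t \<le> 1\<rbrakk> \<Longrightarrow>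
      \<exists>z\<in>A. f z \<le> (1 - t) * f x + t * f y \<and> g z \<le> (1 - t) * g x + t * g y"
    and no: "\<And>x. x \<in> A \<Longrightarrow> f x < 0 \<Longrightarrow> g x < 0 \<Longrightarrow> False"
  shows "\<exists>m. 0 \<le> m \<and> m \<le> 1 \<and> (\<forall>x\<in>A. 0 \<le> m * f x + (1 - m) * g x)"
proof (cases "A = {}")
  case True
  then show ?thesis by (intro exI[of _ 0]) auto
next
  case False
  define N :: "(real \<times> real) set" where "N = {..<0} \<times> {..<0}"
  define S where "S = {(s, t). \<exists>x\<in>A. f x \<le> s \<and> g x \<le> t}"
  have N: "convex N" "N \<noteq> {}"
    unfolding N_def by (auto intro!: convex_Times)
  have "convex S"
    unfolding convex_alt
  proof (intro ballI allI impI)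
    fix p q and t :: real
    assume "p \<in> S" "q \<in> S" and t: "0 \<le> t \<and> t \<le> 1"
    then obtain x y where x: "x \<in> A" "f x \<le> fst p" "g x \<le> snd p"
      and y: "y \<in> A" "f y \<le> fst q" "g y \<le> snd q"
      unfolding S_def by auto
    obtain z where z: "z \<in> A" "f z \<le> (1 - t) * f x + t * f y" "g z \<le> (1 - t) * g x + t * g y"
      using cl[OF x(1) y(1)] t by blast
    have "f z \<le> (1 - t) * fst p + t * fst q"
      by (rule order_trans[OF z(2)]) (use x y t in \<open>auto intro!: add_mono mult_left_mono\<close>)
    moreover have "g z \<le> (1 - t) * snd p + t * snd q"
      by (rule order_trans[OF z(3)]) (use x y t in \<open>auto intro!: add_mono mult_left_mono\<close>)
    ultimately show "(1 - t) *\<^sub>R p + t *\<^sub>R q \<in> S"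
      using z(1) unfolding S_def by (auto simp: case_prod_beta)
  qed
  moreover have "S \<noteq> {}" using False unfolding S_def by auto
  moreover have "N \<inter> S = {}"
    using no unfolding N_def S_def by force
  ultimately obtain a r where ar: "a \<noteq> 0" "\<forall>x\<in>N. inner a x \<le> r" "\<forall>x\<in>S. inner a x \<ge> r"
    using separating_hyperplane_sets[OF N(1) _ N(2)] by metis
  obtain \<alpha> \<beta> where a: "a = (\<alpha>, \<beta>)" by (cases a)
  have neg: "\<alpha> * s + \<beta> * t \<le> r" if "s < 0" "t < 0" for s t
    using ar(2) that unfolding N_def a by (auto simp: inner_prod_def)
  have pos: "r \<le> \<alpha> * s + \<beta> * t" if "x \<in> A" "f x \<le> s" "g x \<le> t" for x s t
    using ar(3) that unfolding S_def a by (auto simp: inner_prod_def)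
  \<comment> \<open>The origin is a limit of points of \<open>N\<close>.\<close>
  have r0: "0 \<le> r"
  proof (rule tendsto_upperbound)
    show "((\<lambda>e. \<alpha> * (-e) + \<beta> * (-e)) \<longlongrightarrow> 0) (at_right (0::real))"
      by (auto intro!: tendsto_eq_intros)
    show "\<forall>\<^sub>F e in at_right 0. \<alpha> * (-e) + \<beta> * (-e) \<le> r"
      using eventually_at_right_less[of "0::real"]
      by eventually_elim (rule neg, auto)
  qed simp
  obtain x0 where x0: "x0 \<in> A" using False by auto
  have "0 \<le> \<alpha>"
  proof (rule ccontr)
    assume "\<not> 0 \<le> \<alpha>"
    \<comment> \<open>\<open>s\<close> is so large that the functional is at least
      \<open>r + 1\<close> at the point \<open>(-s, -1)\<close> of \<open>N\<close>, against
      \<open>neg\<close>; the 1 keeps \<open>s\<close> positive.\<close>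
    define s where "s = max 1 ((\<bar>\<beta>\<bar> + r + 1) / (-\<alpha>))"
    have "(\<bar>\<beta>\<bar> + r + 1) / (-\<alpha>) \<le> s" unfolding s_def by (rule max.cobounded2)
    then have "\<bar>\<beta>\<bar> + r + 1 \<le> s * (-\<alpha>)"
      using \<open>\<not> 0 \<le> \<alpha>\<close> by (subst (asm) pos_divide_le_eq) auto
    moreover have "\<alpha> * (-s) + \<beta> * (-1) \<le> r" by (rule neg) (auto simp: s_def)
    ultimately show False by (auto simp: algebra_simps abs_if split: if_splits)
  qed
  moreover have "0 \<le> \<beta>"
  proof (rule ccontr)
    assume "\<not> 0 \<le> \<beta>"
    define s where "s = max 1 ((\<bar>\<alpha>\<bar> + r + 1) / (-\<beta>))"
    have "(\<bar>\<alpha>\<bar> + r + 1) / (-\<beta>) \<le> s" unfolding s_def by (rule max.cobounded2)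
    then have "\<bar>\<alpha>\<bar> + r + 1 \<le> s * (-\<beta>)"
      using \<open>\<not> 0 \<le> \<beta>\<close> by (subst (asm) pos_divide_le_eq) auto
    moreover have "\<alpha> * (-1) + \<beta> * (-s) \<le> r" by (rule neg) (auto simp: s_def)
    ultimately show False by (auto simp: algebra_simps abs_if split: if_splits)
  qed
  moreover have "(\<alpha>, \<beta>) \<noteq> 0" using ar(1) a by simp
  ultimately have sum: "0 \<le> \<alpha>" "0 \<le> \<beta>" "0 < \<alpha> + \<beta>" by (auto simp: zero_prod_def)
  show ?thesis
  proof (intro exI[of _ "\<alpha> / (\<alpha> + \<beta>)"] conjI ballI)
    fix x assume "x \<in> A"
    then have "0 \<le> (\<alpha> * f x + \<beta> * g x) / (\<alpha> + \<beta>)"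
      using pos[of x "f x" "g x"] r0 sum by auto
    also have "\<dots> = \<alpha> / (\<alpha> + \<beta>) * f x + (1 - \<alpha> / (\<alpha> + \<beta>)) * g x"
      using sum by (simp add: diff_divide_eq_iff add_divide_distrib)
    finally show "0 \<le> \<alpha> / (\<alpha> + \<beta>) * f x + (1 - \<alpha> / (\<alpha> + \<beta>)) * g x" .
  qed (use sum in auto)
qed

text \<open>Induction on the index set, with \<open>A\<close> varying: on the part \<open>B\<close>
  of \<open>A\<close> where \<open>F j\<close> is negative the other functions already have
  multipliers. Their combination \<open>g\<close> and \<open>F j\<close> are then never negative
  together on \<open>A\<close>, and the case of two functions supplies the ratio between
  them.\<close>

lemma convexlike_alternative:
  fixes F :: "'i \<Rightarrow> 'a \<Rightarrow> real"
  assumes "finite I" "I \<noteq> {}"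
    and "\<And>x y t. \<lbrakk>x \<in> A; y \<in> A; 0 \<le> t; t \<le> 1\<rbrakk> \<Longrightarrow>
      \<exists>z\<in>A. \<forall>i\<in>I. F i z \<le> (1 - t) * F i x + t * F i y"
    and "\<not> (\<exists>x\<in>A. \<forall>i\<in>I. F i x < 0)"
  shows "\<exists>l. (\<forall>i\<in>I. 0 \<le> l i) \<and> sum l I = 1 \<and> (\<forall>x\<in>A. 0 \<le> (\<Sum>i\<in>I. l i * F i x))"
  using assms
proof (induction I arbitrary: A rule: finite_ne_induct)
  case (singleton i)
  then show ?case by (intro exI[of _ "\<lambda>_. 1"]) (auto simp: not_less)
next
  case (insert j I)
  define B where "B = {x \<in> A. F j x < 0}"
  have "\<exists>z\<in>B. \<forall>i\<in>I. F i z \<le> (1 - t) * F i x + t * F i y"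
    if "x \<in> B" "y \<in> B" and t: "0 \<le> t" "t \<le> 1" for x y t
  proof -
    have xy: "x \<in> A" "y \<in> A" "F j x < 0" "F j y < 0" using that unfolding B_def by auto
    obtain z where z: "z \<in> A" "\<forall>i\<in>insert j I. F i z \<le> (1 - t) * F i x + t * F i y"
      using insert.prems(1)[OF xy(1,2) t] by blast
    \<comment> \<open>The point \<open>z\<close> has to stay in \<open>B\<close>, where
      \<open>F j\<close> is strictly negative.\<close>
    have "(1 - t) * F j x + t * F j y < 0"
      using convex_bound_lt[of "F j x" 0 "F j y" "1 - t" t] xy t by simp
    then show ?thesis using z unfolding B_def by force
  qed
  moreover have "\<not> (\<exists>x\<in>B. \<forall>i\<in>I. F i x < 0)"
    using insert.prems(2) unfolding B_def by auto
  ultimately obtain l where l: "\<forall>i\<in>I. 0 \<le> l i" "sum l I = 1"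
    "\<forall>x\<in>B. 0 \<le> (\<Sum>i\<in>I. l i * F i x)"
    using insert.IH[of B] by blast
  define g where "g x = (\<Sum>i\<in>I. l i * F i x)" for x
  have "\<exists>m. 0 \<le> m \<and> m \<le> 1 \<and> (\<forall>x\<in>A. 0 \<le> m * g x + (1 - m) * F j x)"
  proof (rule convexlike_alternative_two)
    fix x y and t :: real
    assume xy: "x \<in> A" "y \<in> A" "0 \<le> t" "t \<le> 1"
    obtain z where z: "z \<in> A" "\<forall>i\<in>insert j I. F i z \<le> (1 - t) * F i x + t * F i y"
      using insert.prems(1)[OF xy] by blast
    have "g z \<le> (\<Sum>i\<in>I. l i * ((1 - t) * F i x + t * F i y))"
      unfolding g_def using z l by (intro sum_mono mult_left_mono) auto
    also have "\<dots> = (1 - t) * g x + t * g y"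
      unfolding g_def by (simp add: sum_distrib_left sum.distrib[symmetric] algebra_simps)
    finally show "\<exists>z\<in>A. g z \<le> (1 - t) * g x + t * g y \<and> F j z \<le> (1 - t) * F j x + t * F j y"
      using z by auto
  next
    fix x assume "x \<in> A" "g x < 0" "F j x < 0"
    then show False using l(3) unfolding B_def g_def by force
  qed
  then obtain m where m: "0 \<le> m" "m \<le> 1" "\<forall>x\<in>A. 0 \<le> m * g x + (1 - m) * F j x" by blast
  define l' where "l' i = (if i = j then 1 - m else m * l i)" for i
  have eq: "(\<Sum>i\<in>insert j I. l' i * h i) = m * (\<Sum>i\<in>I. l i * h i) + (1 - m) * h j" for h
  proof -
    have "(\<Sum>i\<in>I. l' i * h i) = (\<Sum>i\<in>I. m * (l i * h i))"
      using insert.hyps by (intro sum.cong) (auto simp: l'_def)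
    then show ?thesis
      using insert.hyps by (simp add: sum_distrib_left l'_def)
  qed
  show ?case
  proof (intro exI[of _ l'] conjI ballI)
    show "sum l' (insert j I) = 1" using eq[of "\<lambda>_. 1"] l(2) by simp
    show "0 \<le> (\<Sum>i\<in>insert j I. l' i * F i x)" if "x \<in> A" for x
      using eq[of "\<lambda>i. F i x"] m(3) that by (simp add: g_def)
  qed (use l m in \<open>auto simp: l'_def\<close>)
qed

text \<open>The pair of weighted integrals is separated from the closed convex epigraph of \<open>g\<close>;
  mass missing in the weight \<open>w\<close> is placed at the zero \<open>c\<close> of \<open>g\<close>.\<close>
lemma weighted_jensen:
  fixes g :: "'a::euclidean_space \<Rightarrow> real"
  assumes M: "finite_measure M" and spM: "space M = X" and idM: "(\<lambda>y. y) \<in> borel_measurable M"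
    and X: "compact X" "convex X" and c: "c \<in> X"
    and g: "convex_on X g" "continuous_on X g" "g c = 0" and gM: "g \<in> borel_measurable M"
    and w: "w \<in> borel_measurable M" "\<And>y. y \<in> X \<Longrightarrow> 0 \<le> w y" "\<And>y. y \<in> X \<Longrightarrow> w y \<le> 1"
    and a: "0 < a" "(\<integral>y. w y \<partial>M) \<le> a"
  shows "c + (1 / a) *\<^sub>R (\<integral>y. w y *\<^sub>R (y - c) \<partial>M) \<in> X \<and>
    a * g (c + (1 / a) *\<^sub>R (\<integral>y. w y *\<^sub>R (y - c) \<partial>M)) \<le> (\<integral>y. w y * g y \<partial>M)"
proof -
  interpret finite_measure M by fact
  define z where "z = c + (1 / a) *\<^sub>R (\<integral>y. w y *\<^sub>R (y - c) \<partial>M)"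
  define E where "E = epigraph X g"
  define V where "V = (\<integral>y. w y *\<^sub>R (y - c) \<partial>M)"
  define G where "G = (\<integral>y. w y * g y \<partial>M)"
  define m where "m = (\<integral>y. w y \<partial>M)"
  have E: "convex E" "closed E"
  proof -
    show "convex E" unfolding E_def using g(1) by (simp add: convex_epigraph)
    have "closed {xy \<in> X \<times> UNIV. g (fst xy) \<le> snd xy}"
      by (intro continuous_on_closed_Collect_le continuous_intros closed_Times compact_imp_closed
          continuous_on_compose2[OF g(2)] X) auto
    also have "{xy \<in> X \<times> UNIV. g (fst xy) \<le> snd xy} = E"
      unfolding E_def epigraph_def by auto
    finally show "closed E" .
  qed
  obtain BX where BX: "\<And>y. y \<in> X \<Longrightarrow> norm (y - c) \<le> BX"
    using compact_imp_bounded[OF X(1)] unfolding bounded_any_center[where a = c]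
    by (auto simp: dist_norm norm_minus_commute)
  obtain Bg where Bg: "\<And>y. y \<in> X \<Longrightarrow> norm (g y) \<le> Bg"
    using compact_imp_bounded[OF compact_continuous_image[OF g(2) X(1)]]
    by (auto simp: bounded_iff)
  note [measurable] = w(1) gM idM
  have le: "w y * t \<le> s" if "y \<in> X" "t \<le> s" "0 \<le> t" for y t s
    using mult_right_mono[OF w(3)[OF that(1)] that(3)] that by simp
  have int_w: "integrable M w"
    by (rule integrable_const_bound[where B = 1]) (auto intro!: AE_I2 simp: spM w)
  have int_V: "integrable M (\<lambda>y. w y *\<^sub>R (y - c))"
    by (rule integrable_const_bound[where B = BX]) (auto intro!: AE_I2 le BX simp: spM w)
  have int_G: "integrable M (\<lambda>y. w y * g y)"
    by (rule integrable_const_bound[where B = Bg])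
      (use Bg in \<open>auto intro!: AE_I2 le simp: spM w abs_mult\<close>)
  \<comment> \<open>A single membership in the epigraph yields both claims: the point lies in
    \<open>X\<close>, and \<open>g\<close> there is at most \<open>G / a\<close>.\<close>
  have "(z, G / a) \<in> E"
  proof (rule ccontr)
    assume "(z, G / a) \<notin> E"
    from separating_hyperplane_closed_point[OF E this]
    obtain p1 p2 \<beta> where sep: "inner (p1, p2) (z, G / a) < \<beta>" "\<forall>x\<in>E. \<beta> < inner (p1, p2) x"
      by auto
    have bd: "\<beta> < p1 \<bullet> y + p2 * g y" if "y \<in> X" for y
      using sep(2)[rule_format, of "(y, g y)"] that by (auto simp: E_def mem_epigraph)
    have "(\<beta> - p1 \<bullet> c) * m = (\<integral>y. w y * (\<beta> - p1 \<bullet> c) \<partial>M)"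
      unfolding m_def by (simp add: int_w)
    also have "\<dots> \<le> (\<integral>y. p1 \<bullet> (w y *\<^sub>R (y - c)) + p2 * (w y * g y) \<partial>M)"
    proof (rule integral_mono)
      fix y assume "y \<in> space M"
      then have "w y * (\<beta> - p1 \<bullet> c) \<le> w y * (p1 \<bullet> (y - c) + p2 * g y)"
        using bd[of y] w(2) by (intro mult_left_mono) (auto simp: spM inner_diff_right)
      then show "w y * (\<beta> - p1 \<bullet> c) \<le> p1 \<bullet> (w y *\<^sub>R (y - c)) + p2 * (w y * g y)"
        by (simp add: algebra_simps)
    qed (use int_w int_V int_G in \<open>auto simp del: inner_scaleR_right\<close>)
    also have "\<dots> = p1 \<bullet> V + p2 * G"
      unfolding V_def G_def using int_V int_G by (simp del: inner_scaleR_right)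
    finally have 1: "(\<beta> - p1 \<bullet> c) * m \<le> p1 \<bullet> V + p2 * G" .
    \<comment> \<open>Since \<open>g c = 0\<close>, the point \<open>(c, 0)\<close> is in the
      epigraph. The sign allows the mass \<open>m\<close> to be raised to \<open>a\<close>, which is
      what placing the missing mass \<open>a - m\<close> at \<open>c\<close> amounts to.\<close>
    have "\<beta> - p1 \<bullet> c \<le> 0" using bd[OF c] g(3) by simp
    then have "(\<beta> - p1 \<bullet> c) * a \<le> (\<beta> - p1 \<bullet> c) * m"
      using a(2) by (intro mult_left_mono_neg) (auto simp: m_def)
    with 1 have "(\<beta> - p1 \<bullet> c) * a \<le> p1 \<bullet> V + p2 * G" by simp
    then have "\<beta> \<le> p1 \<bullet> c + (p1 \<bullet> V + p2 * G) / a"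
      using a(1) by (simp add: field_simps)
    also have "\<dots> = inner (p1, p2) (z, G / a)"
      unfolding z_def V_def[symmetric] using a(1) by (simp add: inner_add_right field_simps)
    finally show False using sep(1) by simp
  qed
  then show ?thesis
    using a(1) by (simp add: E_def mem_epigraph z_def G_def field_simps)
qed

section \<open>The cube, the l1 norm and the class U\<close>

lemma l1norm_nonneg: "0 \<le> l1norm x"
  unfolding l1norm_def by (intro sum_nonneg) auto

lemma l1norm_triangle: "l1norm (x + y) \<le> l1norm x + l1norm y"
  unfolding l1norm_def sum.distrib[symmetric] by (intro sum_mono) auto

lemma l1norm_scaleR: "l1norm (t *\<^sub>R x) = \<bar>t\<bar> * l1norm x"
  unfolding l1norm_def by (simp add: abs_mult sum_distrib_left)

lemma l1norm_minus_commute: "l1norm (x - y) = l1norm (y - x)"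
  unfolding l1norm_def by (simp add: abs_minus_commute)

lemma continuous_on_l1norm [continuous_intros]:
  "continuous_on S h \<Longrightarrow> continuous_on S (\<lambda>x. l1norm (h x))"
  unfolding l1norm_def by (intro continuous_intros)

lemma l1norm_le_norm: "l1norm (x :: real^'n) \<le> real CARD('n) * norm x"
  unfolding l1norm_def
  using sum_mono[of UNIV "\<lambda>i. \<bar>x $ i\<bar>" "\<lambda>_. norm x"] by (simp add: component_le_norm_cart)

text \<open>Hoelder's inequality for the l1 norm and its dual: slopes with entries in [-1, 1] give
  linear functions that are 1-Lipschitz for \<open>l1norm\<close>.\<close>

lemma inner_le_l1norm:
  assumes "\<And>i. \<bar>q $ i\<bar> \<le> 1"
  shows "q \<bullet> x \<le> l1norm x"
  unfolding inner_vec_def l1norm_def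
proof (intro sum_mono)
  fix i
  have "q $ i \<bullet> x $ i \<le> \<bar>q $ i\<bar> * \<bar>x $ i\<bar>"
    using abs_ge_self[of "q $ i * x $ i"] by (simp add: abs_mult)
  also have "\<dots> \<le> \<bar>x $ i\<bar>"
    using mult_right_mono[OF assms, of "\<bar>x $ i\<bar>"] by simp
  finally show "q $ i \<bullet> x $ i \<le> \<bar>x $ i\<bar>" .
qed

text \<open>Equality in the preceding bound is reached at a sign vector. The l1 norm is thus a
  maximum of finitely many linear functions, the form that the theorem of the alternative can
  handle.\<close>

lemma l1norm_eq_inner_signs: "l1norm x = (\<chi> i. if x $ i < 0 then -1 else 1) \<bullet> x"
  unfolding inner_vec_def l1norm_def by (intro sum.cong) auto

text \<open>Serves for the grid of rounded points as well as for the sign vectors.\<close>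

lemma finite_vec_components:
  assumes "finite B"
  shows "finite {x :: 'a^'n. \<forall>i. x $ i \<in> B}"
proof (rule finite_subset)
  show "{x :: 'a^'n. \<forall>i. x $ i \<in> B} \<subseteq> (\<lambda>h. \<chi> i. h i) ` (UNIV \<rightarrow>\<^sub>E B)"
    by (auto intro!: image_eqI[of _ _ "\<lambda>i. _ $ i"] simp: vec_eq_iff)
  show "finite ((\<lambda>h. \<chi> i. h i) ` (UNIV \<rightarrow>\<^sub>E B) :: ('a^'n) set)"
    using assms by (intro finite_imageI finite_PiE) auto
qed

lemma compact_cube: "compact (cube b)" and convex_cube: "convex (cube b)"
  unfolding cube_def by (auto intro: convex_box)

text \<open>Coordinates are rounded down to a grid that contains 0, so no point leaves the
  cube.\<close>

lemma cube_rounding: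
  assumes "0 < e"
  shows "\<exists>T :: real^'n \<Rightarrow> real^'n. T \<in> borel_measurable borel \<and> finite (T ` cube b) \<and>
    (\<forall>x\<in>cube b. T x \<in> cube b \<and> l1norm (x - T x) \<le> e)"
proof -
  \<comment> \<open>The mesh is \<open>e\<close> over the dimension, so that the coordinate errors
    add up to at most \<open>e\<close>.\<close>
  define d where "d = e / CARD('n)"
  have d: "0 < d" using assms unfolding d_def by simp
  define T :: "real^'n \<Rightarrow> real^'n" where "T x = (\<chi> i. d * \<lfloor>x $ i / d\<rfloor>)" for x
  have lo: "d * \<lfloor>t / d\<rfloor> \<le> t" for t
    using d mult_left_mono[OF of_int_floor_le[of "t / d"], of d] by simp
  have hi: "t \<le> d * \<lfloor>t / d\<rfloor> + d" for t
  proof -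
    have "t / d \<le> \<lfloor>t / d\<rfloor> + 1" using real_of_int_floor_add_one_ge by simp
    then have "t \<le> (\<lfloor>t / d\<rfloor> + 1) * d" by (rule pos_divide_le_eq[OF d, THEN iffD1])
    then show ?thesis by (simp add: algebra_simps)
  qed
  have meas: "T \<in> borel_measurable borel"
  proof (subst borel_measurable_euclidean_space, intro ballI)
    fix v :: "real^'n" assume "v \<in> Basis"
    then obtain i where "v = axis i 1" unfolding Basis_vec_def by auto
    then have eq: "(\<lambda>x. T x \<bullet> v) = (\<lambda>x. d * \<lfloor>x $ i / d\<rfloor>)"
      by (simp add: T_def inner_axis)
    show "(\<lambda>x. T x \<bullet> v) \<in> borel_measurable borel"
      unfolding eq by measurable
  qed
  have "T ` cube b \<subseteq> {x. \<forall>i. x $ i \<in> (\<lambda>m. d * of_int m) ` {0..\<lfloor>b / d\<rfloor>}}"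
    using d by (auto simp: T_def cube_def mem_box_cart intro!: imageI floor_mono divide_right_mono)
  then have fin: "finite (T ` cube b)"
    by (rule finite_subset) (intro finite_vec_components finite_imageI finite_atLeastAtMost_int)
  have "T x \<in> cube b \<and> l1norm (x - T x) \<le> e" if "x \<in> cube b" for x
  proof
    show "T x \<in> cube b"
      using that d lo order_trans[OF lo] by (auto simp: T_def cube_def mem_box_cart)
    have "l1norm (x - T x) \<le> (\<Sum>i\<in>(UNIV::'n set). d)"
      unfolding l1norm_def
    proof (intro sum_mono)
      fix i
      show "\<bar>(x - T x) $ i\<bar> \<le> d"
        using lo[of "x $ i"] hi[of "x $ i"] by (simp add: T_def)
    qed
    then show "l1norm (x - T x) \<le> e" by (simp add: d_def)
  qed
  then show ?thesis using meas fin by blast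
qed

lemma U_class_continuous_on:
  fixes u :: "real^'n \<Rightarrow> real"
  assumes "u \<in> U_class b c"
  shows "continuous_on (cube b) u"
proof -
  have "(real CARD('n))-lipschitz_on (cube b) u"
  proof (rule lipschitz_onI)
    fix x y :: "real^'n" assume xy: "x \<in> cube b" "y \<in> cube b"
    have "dist (u x) (u y) \<le> l1norm (x - y)"
      using assms xy by (auto simp: U_class_def dist_real_def)
    also have "\<dots> \<le> real CARD('n) * dist x y"
      unfolding dist_norm by (rule l1norm_le_norm)
    finally show "dist (u x) (u y) \<le> real CARD('n) * dist x y" .
  qed simp
  then show ?thesis by (rule lipschitz_on_continuous_on)
qed

text \<open>Members of \<open>U_class\<close> are constrained on the cube only and may be arbitrary
  outside it, so measurability is meant with respect to the Borel sets of \<open>X\<close>.\<close>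

lemma continuous_on_measurable_cube:
  fixes h :: "'a::topological_space \<Rightarrow> 'b::topological_space"
  assumes "sets M = sets (restrict_space borel X)" "continuous_on X h"
  shows "h \<in> borel_measurable M"
  using borel_measurable_continuous_on_restrict[OF assms(2)] measurable_cong_sets[OF assms(1) refl]
  by blast

text \<open>Continuity on a compact set bounds \<open>h\<close>, and a finite measure integrates
  bounded measurable functions. Applied to the cube and to its square.\<close>

lemma continuous_on_compact_integrable:
  fixes h :: "'a::topological_space \<Rightarrow> 'b::{second_countable_topology, banach}"
  assumes "sets M = sets (restrict_space borel X)" "finite_measure M"
    "compact X" "continuous_on X h"
  shows "integrable M h"
proof -
  interpret finite_measure M by fact
  obtain B where B: "\<And>y. y \<in> X \<Longrightarrow> norm (h y) \<le> B"
    using compact_imp_bounded[OF compact_continuous_image[OF assms(4,3)]]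
    by (auto simp: bounded_iff)
  have "space M = X" using sets_eq_imp_space_eq[OF assms(1)] by (simp add: space_restrict_space)
  then show ?thesis
    using B continuous_on_measurable_cube[OF assms(1,4)]
    by (intro integrable_const_bound[where B = B] AE_I2) auto
qed

text \<open>The 0 in the maximum gives nonnegativity, the offsets \<open>s k\<close> give the value
  0 at \<open>c\<close>, and the bound on the slopes gives the Lipschitz condition. The multipliers
  of the transport problem are turned into a function of this kind; \<open>K = {}\<close> yields the
  zero function.\<close>

lemma Max_affine_in_U_class:
  fixes q :: "real^'n \<Rightarrow> real^'n" and K :: "(real^'n) set"
  assumes "finite K" "c \<in> cube b"
    and q: "\<And>k i. k \<in> K \<Longrightarrow> \<bar>q k $ i\<bar> \<le> 1" and s: "\<And>k. k \<in> K \<Longrightarrow> 0 \<le> s k"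
  shows "(\<lambda>y. Max (insert 0 ((\<lambda>k. q k \<bullet> (y - c) - s k) ` K))) \<in> U_class b c"
proof -
  define L where "L y = insert 0 ((\<lambda>k. q k \<bullet> (y - c) - s k) ` K)" for y
  have fin: "finite (L y)" "L y \<noteq> {}" for y using assms(1) by (auto simp: L_def)
  have nn: "0 \<le> Max (L y)" for y by (rule Max_ge) (use fin in \<open>auto simp: L_def\<close>)
  have le: "q k \<bullet> (y - c) - s k \<le> Max (L y)" if "k \<in> K" for k y
    by (rule Max_ge) (use fin that in \<open>auto simp: L_def\<close>)
  have conv: "convex_on (cube b) (\<lambda>y. Max (L y))"
  proof (rule convex_onI)
    fix t :: real and x y :: "real^'n"
    assume t: "0 < t" "t < 1" 
    show "Max (L ((1 - t) *\<^sub>R x + t *\<^sub>R y)) \<le> (1 - t) * Max (L x) + t * Max (L y)"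
    proof (rule Max.boundedI)
      fix r assume "r \<in> L ((1 - t) *\<^sub>R x + t *\<^sub>R y)"
      then consider "r = 0" | k where "k \<in> K"
        "r = q k \<bullet> ((1 - t) *\<^sub>R x + t *\<^sub>R y - c) - s k" by (auto simp: L_def)
      then show "r \<le> (1 - t) * Max (L x) + t * Max (L y)"
      proof cases
        case 1
        then show ?thesis using nn t by auto
      next
        case 2
        then have "r = (1 - t) * (q k \<bullet> (x - c) - s k) + t * (q k \<bullet> (y - c) - s k)"
          by (simp add: inner_diff_right inner_add_right algebra_simps)
        also have "\<dots> \<le> (1 - t) * Max (L x) + t * Max (L y)"
          using le[OF 2(1)] t by (intro add_mono mult_left_mono) auto
        finally show ?thesis .
      qed
    qed (use fin in auto)
  qed (rule convex_cube)
  have half: "Max (L x) \<le> Max (L y) + l1norm (x - y)" for x y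
  proof (rule Max.boundedI)
    fix r assume "r \<in> L x"
    then consider "r = 0" | k where "k \<in> K" "r = q k \<bullet> (x - c) - s k" by (auto simp: L_def)
    then show "r \<le> Max (L y) + l1norm (x - y)"
    proof cases
      case 1
      then show ?thesis using nn[of y] l1norm_nonneg[of "x - y"] by simp
    next
      case 2
      have "r = (q k \<bullet> (y - c) - s k) + q k \<bullet> (x - y)"
        using 2 by (simp add: inner_diff_right)
      then show ?thesis
        using le[OF 2(1), of y] inner_le_l1norm[of "q k" "x - y"] q[OF 2(1)] by auto
    qed
  qed (use fin in auto)
  have lip: "\<bar>Max (L x) - Max (L y)\<bar> \<le> l1norm (x - y)" for x y
    using half[of x y] half[of y x] l1norm_minus_commute[of x y] by linarith
  have "Max (L c) \<le> 0"
    by (rule Max.boundedI) (use assms(1) s in \<open>auto simp: L_def\<close>)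
  with nn[of c] have "Max (L c) = 0" by simp
  then show ?thesis
    using nn conv lip unfolding U_class_def L_def by blast
qed

section \<open>Optimal transport weights\<close>

text \<open>\<open>w k y\<close> is the share of the mass of \<open>mm\<close> at \<open>y\<close>
  assigned to the point \<open>k\<close>, which carries mass \<open>a k\<close>. The cost compares
  \<open>k\<close> with the barycentre of its piece, completed by mass at \<open>c\<close>. The
  strict bound in the hypothesis contradicts the weak inequality that the alternative
  delivers.\<close>

lemma transport_weights_exist:
  fixes K :: "(real^'n) set" and a :: "real^'n \<Rightarrow> real"
  assumes mm: "finite_measure mm" "sets mm = sets (restrict_space borel (cube b))"
    and c: "c \<in> cube b"
    and K: "finite K" and a: "\<And>k. k \<in> K \<Longrightarrow> 0 < a k"
    and V: "\<And>u. u \<in> U_class b c \<Longrightarrow> (\<Sum>k\<in>K. a k * u k) - (\<integral>y. u y \<partial>mm) < V"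
  shows "\<exists>w. (\<forall>k\<in>K. w k \<in> borel_measurable mm \<and> (\<forall>y\<in>cube b. 0 \<le> w k y)
        \<and> (\<integral>y. w k y \<partial>mm) \<le> a k)
      \<and> (\<forall>y\<in>cube b. (\<Sum>k\<in>K. w k y) \<le> 1)
      \<and> (\<Sum>k\<in>K. l1norm (a k *\<^sub>R (k - c) - (\<integral>y. w k y *\<^sub>R (y - c) \<partial>mm))) \<le> V"
proof -

  \<comment> \<open>The weights as a finite system of affine inequalities\<close>
  interpret finite_measure mm by fact
  have sp: "space mm = cube b"
    using sets_eq_imp_space_eq[OF mm(2)] by (simp add: space_restrict_space)
  have id_m [measurable]: "(\<lambda>y. y) \<in> borel_measurable mm"
    by (rule continuous_on_measurable_cube[OF mm(2)]) auto
  \<comment> \<open>A sum of at most 1 means that the pieces together stay below \<open>mm\<close>.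
    The capacities \<open>a k\<close> are not part of \<open>A\<close>: they enter through
    \<open>F\<close>, so that they receive multipliers.\<close>
  define A where "A = {w :: real^'n \<Rightarrow> real^'n \<Rightarrow> real.
    (\<forall>k\<in>K. w k \<in> borel_measurable mm \<and> (\<forall>y\<in>cube b. 0 \<le> w k y)) \<and>
    (\<forall>y\<in>cube b. (\<Sum>k\<in>K. w k y) \<le> 1)}"
  \<comment> \<open>This is \<open>a k\<close> times the vector to \<open>k\<close> from the
    barycentre of its piece, the mass lacking up to \<open>a k\<close> being placed at
    \<open>c\<close>.\<close>
  define D where "D k w = a k *\<^sub>R (k - c) - (\<integral>y. w k y *\<^sub>R (y - c) \<partial>mm)"
    for k and w :: "real^'n \<Rightarrow> real^'n \<Rightarrow> real"
  \<comment> \<open>One sign vector for each \<open>k\<close>: the total l1 cost is the maximum of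
    \<open>\<Sum>k\<in>K. \<sigma> k \<bullet> D k w\<close> over \<open>\<Sigma>\<close>, so
    bounding it by \<open>V\<close> amounts to finitely many affine conditions on
    \<open>w\<close>.\<close>
  define \<Sigma> where "\<Sigma> = (\<Pi>\<^sub>E k\<in>K. {\<sigma> :: real^'n. \<forall>i. \<sigma> $ i \<in> {-1, 1}})"
  define I where "I = K <+> \<Sigma>"
  define F where "F i w = (case i of Inl k \<Rightarrow> (\<integral>y. w k y \<partial>mm) - a k
    | Inr \<sigma> \<Rightarrow> (\<Sum>k\<in>K. \<sigma> k \<bullet> D k w) - V)" for i w
  have fin\<Sigma>: "finite \<Sigma>" unfolding \<Sigma>_def
    by (intro finite_PiE K finite_vec_components) auto
  have "(\<lambda>k\<in>K. \<chi> i. 1) \<in> \<Sigma>" unfolding \<Sigma>_def by auto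
  then have ne\<Sigma>: "\<Sigma> \<noteq> {}" by blast
  have finI: "finite I" "I \<noteq> {}" unfolding I_def using fin\<Sigma> ne\<Sigma> K by auto
  have w_le: "w k y \<le> 1" if "w \<in> A" "k \<in> K" "y \<in> cube b" for w k y
    using member_le_sum[of k K "\<lambda>k. w k y"] that K unfolding A_def by fastforce
  have int_w: "integrable mm (w k)" if "w \<in> A" "k \<in> K" for w k
    using that w_le[OF that]
    by (intro integrable_const_bound[where B = 1] AE_I2) (auto simp: sp A_def)
  have "bounded (cube b :: (real^'n) set)" by (rule compact_imp_bounded[OF compact_cube])
  then obtain BX where BX: "\<And>y. y \<in> cube b \<Longrightarrow> norm (y - c) \<le> BX"
    unfolding bounded_any_center[where a = c]
    by (auto simp: dist_norm norm_minus_commute)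
  have int_D: "integrable mm (\<lambda>y. w k y *\<^sub>R (y - c))" if "w \<in> A" "k \<in> K" for w k
  proof (rule integrable_const_bound[where B = BX])
    show "(\<lambda>y. w k y *\<^sub>R (y - c)) \<in> borel_measurable mm"
      using that unfolding A_def by auto
    show "AE y in mm. norm (w k y *\<^sub>R (y - c)) \<le> BX"
    proof (rule AE_I2)
      fix y assume "y \<in> space mm"
      then have y: "y \<in> cube b" by (simp add: sp)
      have "\<bar>w k y\<bar> * norm (y - c) \<le> 1 * norm (y - c)"
        using w_le[OF that y] that y by (intro mult_right_mono) (auto simp: A_def)
      then show "norm (w k y *\<^sub>R (y - c)) \<le> BX" using BX[OF y] by simp
    qed
  qed
  \<comment> \<open>Every \<open>F i\<close> is affine in the weights, so the mixture
    \<open>z\<close> attains equality.\<close>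
  have convexlike: "\<exists>z\<in>A. \<forall>i\<in>I. F i z \<le> (1 - t) * F i v + t * F i w"
    if vw: "v \<in> A" "w \<in> A" and t: "0 \<le> t" "t \<le> 1" for v w t
  proof -
    define z where "z k y = (1 - t) * v k y + t * w k y" for k y
    have "z \<in> A"
    proof -
      have "(\<Sum>k\<in>K. z k y) \<le> 1" if "y \<in> cube b" for y
      proof -
        have "(\<Sum>k\<in>K. z k y) = (1 - t) * (\<Sum>k\<in>K. v k y) + t * (\<Sum>k\<in>K. w k y)"
          by (simp add: z_def sum.distrib sum_distrib_left)
        also have "\<dots> \<le> 1"
          using vw t that by (intro convex_bound_le) (auto simp: A_def)
        finally show ?thesis .
      qed
      moreover have "z k \<in> borel_measurable mm" if "k \<in> K" for k
        using vw that unfolding z_def A_def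
        by (intro borel_measurable_add borel_measurable_times borel_measurable_const) auto
      moreover have "0 \<le> z k y" if "k \<in> K" "y \<in> cube b" for k y
        using vw that t by (auto simp: A_def z_def)
      ultimately show ?thesis by (auto simp: A_def)
    qed
    moreover have "F i z = (1 - t) * F i v + t * F i w" if "i \<in> I" for i
    proof (cases i)
      case (Inl k)
      then have "k \<in> K" using that by (auto simp: I_def)
      then show ?thesis
        using int_w[OF vw(1)] int_w[OF vw(2)]
        by (simp add: Inl F_def z_def[abs_def] algebra_simps)
    next
      case (Inr \<sigma>)
      have "D k z = (1 - t) *\<^sub>R D k v + t *\<^sub>R D k w" if "k \<in> K" for k
      proof -
        have "(\<integral>y. z k y *\<^sub>R (y - c) \<partial>mm) =
          (\<integral>y. (1 - t) *\<^sub>R (v k y *\<^sub>R (y - c)) + t *\<^sub>R (w k y *\<^sub>R (y - c)) \<partial>mm)"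
          by (simp add: z_def scaleR_add_left)
        also have "\<dots> = (1 - t) *\<^sub>R (\<integral>y. v k y *\<^sub>R (y - c) \<partial>mm) + t *\<^sub>R (\<integral>y. w k y *\<^sub>R (y - c) \<partial>mm)"
          using int_D[OF vw(1) that] int_D[OF vw(2) that]
          by (subst Bochner_Integration.integral_add) (auto simp del: scaleR_scaleR)
        finally show ?thesis by (simp add: D_def algebra_simps)
      qed
      then have "(\<Sum>k\<in>K. \<sigma> k \<bullet> D k z)
          = (\<Sum>k\<in>K. (1 - t) * (\<sigma> k \<bullet> D k v) + t * (\<sigma> k \<bullet> D k w))"
        by (intro sum.cong) (auto simp: inner_add_right)
      also have "\<dots> = (1 - t) * (\<Sum>k\<in>K. \<sigma> k \<bullet> D k v) + t * (\<Sum>k\<in>K. \<sigma> k \<bullet> D k w)"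
        by (simp add: sum.distrib sum_distrib_left)
      finally show ?thesis by (simp add: Inr F_def algebra_simps)
    qed
    ultimately show ?thesis by (intro bexI[of _ z] ballI) (simp_all only: order_refl)
  qed

  \<comment> \<open>Solvability of the system\<close>
  have "\<exists>w\<in>A. \<forall>i\<in>I. F i w < 0"
  proof (rule ccontr)
    assume "\<not> (\<exists>w\<in>A. \<forall>i\<in>I. F i w < 0)"
    from convexlike_alternative[of I A F, OF finI convexlike this]
    obtain l where l: "\<forall>i\<in>I. 0 \<le> l i" "sum l I = 1" "\<forall>w\<in>A. 0 \<le> (\<Sum>i\<in>I. l i * F i w)"
      by blast
    have lnn: "0 \<le> l (Inl k)" if "k \<in> K" for k using l(1) that by (auto simp: I_def)
    have lnn': "0 \<le> l (Inr \<sigma>)" if "\<sigma> \<in> \<Sigma>" for \<sigma> using l(1) that by (auto simp: I_def)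
    define L where "L = (\<Sum>\<sigma>\<in>\<Sigma>. l (Inr \<sigma>))"
    have split: "(\<Sum>i\<in>I. h i) = (\<Sum>k\<in>K. h (Inl k)) + (\<Sum>\<sigma>\<in>\<Sigma>. h (Inr \<sigma>))" for h :: "_ \<Rightarrow> real"
      unfolding I_def using sum.Plus[OF K fin\<Sigma>, of h] by simp
    have w0: "(\<lambda>_ _. 0) \<in> A" unfolding A_def by auto
    have "0 \<le> L" unfolding L_def using lnn' by (rule sum_nonneg)
    \<comment> \<open>Slater's condition: the zero weights meet every capacity strictly, as
      \<open>0 < a k\<close>. With no multiplier on the cost the combination would be negative
      there.\<close>
    have "L \<noteq> 0"
    proof
      assume "L = 0"
      then have z: "\<forall>\<sigma>\<in>\<Sigma>. l (Inr \<sigma>) = 0"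
        unfolding L_def using sum_nonneg_eq_0_iff[OF fin\<Sigma>, of "\<lambda>\<sigma>. l (Inr \<sigma>)"] lnn' by blast
      then have "(\<Sum>k\<in>K. l (Inl k) * a k) \<le> 0"
        using l(3)[rule_format, OF w0] by (simp add: split F_def sum_negf)
      moreover have "\<forall>k\<in>K. 0 \<le> l (Inl k) * a k"
        using lnn a by (simp add: less_imp_le)
      ultimately have "\<forall>k\<in>K. l (Inl k) * a k = 0"
        using sum_nonneg_eq_0_iff[OF K, of "\<lambda>k. l (Inl k) * a k"]
        by (meson order_antisym sum_nonneg)
      then have "\<forall>k\<in>K. l (Inl k) = 0" using a by fastforce
      then have "sum l I = 0" using z by (simp add: split)
      then show False using l(2) by simp
    qed
    with \<open>0 \<le> L\<close> have L: "0 < L" by simp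
    \<comment> \<open>Division by \<open>L\<close> makes \<open>q k\<close> an average of sign
      vectors, so its entries lie in [-1, 1].\<close>
    define q where "q k = (1 / L) *\<^sub>R (\<Sum>\<sigma>\<in>\<Sigma>. l (Inr \<sigma>) *\<^sub>R \<sigma> k)" for k
    define s where "s k = l (Inl k) / L" for k
    have q1: "\<bar>q k $ i\<bar> \<le> 1" if "k \<in> K" for k i
    proof -
      have "\<bar>\<Sum>\<sigma>\<in>\<Sigma>. l (Inr \<sigma>) * \<sigma> k $ i\<bar> \<le> (\<Sum>\<sigma>\<in>\<Sigma>. \<bar>l (Inr \<sigma>) * \<sigma> k $ i\<bar>)"
        by (rule sum_abs)
      also have "\<dots> \<le> L"
        unfolding L_def
      proof (rule sum_mono)
        fix \<sigma> assume \<sigma>: "\<sigma> \<in> \<Sigma>"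
        then have "\<sigma> k $ i \<in> {-1, 1}" using that unfolding \<Sigma>_def by (auto simp: PiE_iff)
        then show "\<bar>l (Inr \<sigma>) * \<sigma> k $ i\<bar> \<le> l (Inr \<sigma>)"
          using lnn'[OF \<sigma>] by (auto simp: abs_mult)
      qed
      finally show ?thesis
        using L by (simp add: q_def sum_component divide_le_eq)
    qed
    have s0: "0 \<le> s k" if "k \<in> K" for k using lnn[OF that] L by (simp add: s_def)
    define e where "e k y = q k \<bullet> (y - c) - s k" for k y
    define u where "u y = Max (insert 0 ((\<lambda>k. e k y) ` K))" for y
    have uU: "u \<in> U_class b c"
      unfolding u_def e_def by (rule Max_affine_in_U_class) (use K c q1 s0 in auto)
    have u_ge: "e k y \<le> u y" if "k \<in> K" for k y
      unfolding u_def using that K by (intro Max_ge) auto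
    have u_in: "u y \<in> insert 0 ((\<lambda>k. e k y) ` K)" for y
      unfolding u_def using K by (intro Max_in) auto
    \<comment> \<open>The mass at \<open>y\<close> is shared equally among the \<open>k\<close> in
      \<open>K\<close> with \<open>e k y = u y\<close>. If only the 0 attains the maximum, then
      \<open>w k y = 0 / 0 = 0\<close> and the mass stays unassigned. This choice maximises
      \<open>\<Sum>k\<in>K. w k y * e k y\<close> among nonnegative weights of sum at most 1, with
      value \<open>u y\<close>.\<close>
    define act where "act k y = (if e k y = u y then 1 else 0 :: real)" for k y
    define w where "w k y = act k y / (\<Sum>j\<in>K. act j y)" for k y
    have um [measurable]: "u \<in> borel_measurable mm"
      by (rule continuous_on_measurable_cube[OF mm(2) U_class_continuous_on[OF uU]])
    have [measurable]: "act k \<in> borel_measurable mm" for k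
      unfolding act_def e_def by measurable
    have act_sum: "(\<Sum>k\<in>K. w k y) \<le> 1" for y
      by (simp add: w_def sum_divide_distrib[symmetric])
    have wm: "w k \<in> borel_measurable mm" for k
      unfolding w_def[abs_def] by measurable
    have w_nn: "0 \<le> w k y" for k y
      by (auto simp: w_def act_def intro!: sum_nonneg divide_nonneg_nonneg)
    have wA: "w \<in> A"
      unfolding A_def using act_sum wm w_nn by auto
    have wu: "(\<Sum>k\<in>K. w k y * e k y) = u y" for y
    proof -
      have "(\<Sum>k\<in>K. w k y * e k y) = (\<Sum>k\<in>K. w k y * u y)"
        by (intro sum.cong) (auto simp: w_def act_def)
      also have "\<dots> = (\<Sum>k\<in>K. act k y) / (\<Sum>k\<in>K. act k y) * u y"
        by (simp add: w_def sum_distrib_right[symmetric] sum_divide_distrib[symmetric])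
      also have "\<dots> = u y"
      proof (cases "\<exists>k\<in>K. e k y = u y")
        case True
        then obtain k where k: "k \<in> K" "e k y = u y" by blast
        have "0 < (\<Sum>k\<in>K. act k y)"
          by (rule sum_pos2[OF K k(1)]) (use k in \<open>auto simp: act_def\<close>)
        then show ?thesis by simp
      next
        case False
        then have "u y = 0" using u_in[of y] by auto
        then show ?thesis by simp
      qed
      finally show ?thesis .
    qed
    have "0 \<le> (\<Sum>k\<in>K. l (Inl k) * ((\<integral>y. w k y \<partial>mm) - a k))
        + (\<Sum>\<sigma>\<in>\<Sigma>. l (Inr \<sigma>) * ((\<Sum>k\<in>K. \<sigma> k \<bullet> D k w) - V))"
      using l(3)[rule_format, OF wA] by (simp add: split F_def)
    also have "(\<Sum>\<sigma>\<in>\<Sigma>. l (Inr \<sigma>) * ((\<Sum>k\<in>K. \<sigma> k \<bullet> D k w) - V))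
        = (\<Sum>k\<in>K. (L *\<^sub>R q k) \<bullet> D k w) - L * V"
    proof -
      have "(\<Sum>\<sigma>\<in>\<Sigma>. l (Inr \<sigma>) * (\<Sum>k\<in>K. \<sigma> k \<bullet> D k w))
          = (\<Sum>k\<in>K. \<Sum>\<sigma>\<in>\<Sigma>. l (Inr \<sigma>) * (\<sigma> k \<bullet> D k w))"
        by (subst sum.swap) (simp add: sum_distrib_left)
      also have "\<dots> = (\<Sum>k\<in>K. (L *\<^sub>R q k) \<bullet> D k w)"
        using L by (intro sum.cong) (auto simp: q_def inner_sum_left)
      finally show ?thesis
        by (simp add: right_diff_distrib sum_subtractf L_def sum_distrib_right)
    qed
    also have "(\<Sum>k\<in>K. l (Inl k) * ((\<integral>y. w k y \<partial>mm) - a k))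
        = L * (\<Sum>k\<in>K. s k * ((\<integral>y. w k y \<partial>mm) - a k))"
      using L by (simp add: s_def sum_distrib_left)
    finally have "0 \<le> L * ((\<Sum>k\<in>K. s k * ((\<integral>y. w k y \<partial>mm) - a k)) + (\<Sum>k\<in>K. q k \<bullet> D k w) - V)"
      by (simp add: algebra_simps sum_distrib_left)
    then have "V \<le> (\<Sum>k\<in>K. s k * ((\<integral>y. w k y \<partial>mm) - a k)) + (\<Sum>k\<in>K. q k \<bullet> D k w)"
      using L by (simp add: zero_le_mult_iff)
    \<comment> \<open>For each \<open>k\<close> the slope and the offset combine into the affine
      function \<open>e k\<close>, taken at \<open>k\<close> with mass \<open>a k\<close> and
      integrated against the piece \<open>w k\<close>.\<close>
    also have "\<dots> = (\<Sum>k\<in>K. a k * e k k - (\<integral>y. w k y * e k y \<partial>mm))"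
      unfolding sum.distrib[symmetric]
    proof (rule sum.cong)
      fix k assume k: "k \<in> K"
      have "(\<integral>y. w k y * e k y \<partial>mm) = (\<integral>y. q k \<bullet> (w k y *\<^sub>R (y - c)) - s k * w k y \<partial>mm)"
        by (intro Bochner_Integration.integral_cong) (auto simp: e_def algebra_simps)
      also have "\<dots> = q k \<bullet> (\<integral>y. w k y *\<^sub>R (y - c) \<partial>mm) - s k * (\<integral>y. w k y \<partial>mm)"
        using int_w[OF wA k] int_D[OF wA k]
        by (subst Bochner_Integration.integral_diff) (auto simp del: inner_scaleR_right)
      finally show "s k * ((\<integral>y. w k y \<partial>mm) - a k) + q k \<bullet> D k w
          = a k * e k k - (\<integral>y. w k y * e k y \<partial>mm)"
        by (simp add: D_def e_def inner_diff_right algebra_simps)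
    qed simp
    also have "\<dots> = (\<Sum>k\<in>K. a k * e k k) - (\<integral>y. (\<Sum>k\<in>K. w k y * e k y) \<partial>mm)"
    proof -
      have "integrable mm (\<lambda>y. w k y * e k y)" if k: "k \<in> K" for k
      proof -
        have "integrable mm (\<lambda>y. q k \<bullet> (w k y *\<^sub>R (y - c)) - s k * w k y)"
          using int_w[OF wA k] int_D[OF wA k] by (auto simp del: inner_scaleR_right)
        also have "(\<lambda>y. q k \<bullet> (w k y *\<^sub>R (y - c)) - s k * w k y) = (\<lambda>y. w k y * e k y)"
          by (auto simp: e_def algebra_simps)
        finally show ?thesis .
      qed
      then show ?thesis by (simp add: Bochner_Integration.integral_sum sum_subtractf)
    qed
    also have "\<dots> \<le> (\<Sum>k\<in>K. a k * u k) - (\<integral>y. u y \<partial>mm)"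
      unfolding wu using a u_ge by (intro diff_right_mono sum_mono mult_left_mono) (auto simp: less_imp_le)
    finally show False using V[OF uU] by simp
  qed
  then obtain w where w: "w \<in> A" "\<forall>i\<in>I. F i w < 0" by blast
  \<comment> \<open>The signs of \<open>D k w\<close> select the one inequality whose left side is
    the l1 cost.\<close>
  define \<sigma> where "\<sigma> = (\<lambda>k\<in>K. \<chi> i. if D k w $ i < 0 then -1 else (1 :: real))"
  have "\<sigma> \<in> \<Sigma>" unfolding \<sigma>_def \<Sigma>_def by auto
  then have "F (Inr \<sigma>) w < 0" using w(2) by (auto simp: I_def)
  moreover have "(\<Sum>k\<in>K. \<sigma> k \<bullet> D k w) = (\<Sum>k\<in>K. l1norm (D k w))"
    by (intro sum.cong) (auto simp: \<sigma>_def l1norm_eq_inner_signs)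
  ultimately have "(\<Sum>k\<in>K. l1norm (D k w)) \<le> V" by (simp add: F_def)
  moreover have "(\<integral>y. w k y \<partial>mm) \<le> a k" if "k \<in> K" for k
    using w(2) that by (force simp: I_def F_def)
  ultimately show ?thesis
    using w(1) unfolding A_def D_def by blast
qed

section \<open>Duality\<close>

lemma measurable_fst_snd_square:
  assumes "\<gamma> \<in> radon_on_square b"
  shows "fst \<in> measurable \<gamma> (restrict_space borel (cube b))"
    and "snd \<in> measurable \<gamma> (restrict_space borel (cube b))"
proof -
  have s: "sets \<gamma> = sets (restrict_space borel (cube b \<times> cube b))"
    using assms unfolding radon_on_square_def by auto
  have sp: "space \<gamma> = cube b \<times> cube b"
    using sets_eq_imp_space_eq[OF s] by (simp add: space_restrict_space)
  have "fst \<in> borel_measurable \<gamma>" "snd \<in> borel_measurable \<gamma>"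
    by (auto intro!: continuous_on_measurable_cube[OF s] continuous_intros)
  then show "fst \<in> measurable \<gamma> (restrict_space borel (cube b))"
    "snd \<in> measurable \<gamma> (restrict_space borel (cube b))"
    by (auto intro!: measurable_restrict_space2 simp: sp)
qed

lemma integral_marginal1:
  fixes g :: "real^'n \<Rightarrow> real"
  assumes "\<gamma> \<in> radon_on_square b" "continuous_on (cube b) g"
  shows "(\<integral>x. g x \<partial>marginal1 b \<gamma>) = (\<integral>xy. g (fst xy) \<partial>\<gamma>)"
  unfolding marginal1_def
  by (rule integral_distr[OF measurable_fst_snd_square(1)[OF assms(1)]
        borel_measurable_continuous_on_restrict[OF assms(2)]])

lemma integral_marginal2:
  fixes g :: "real^'n \<Rightarrow> real"
  assumes "\<gamma> \<in> radon_on_square b" "continuous_on (cube b) g"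
  shows "(\<integral>x. g x \<partial>marginal2 b \<gamma>) = (\<integral>xy. g (snd xy) \<partial>\<gamma>)"
  unfolding marginal2_def
  by (rule integral_distr[OF measurable_fst_snd_square(2)[OF assms(1)]
        borel_measurable_continuous_on_restrict[OF assms(2)]])

text \<open>The two dominations replace \<open>mp\<close> and \<open>mm\<close> by the marginals,
  neither of them lowering the difference; the Lipschitz bound then holds pointwise under the
  integral over \<open>\<gamma>\<close>.\<close>

lemma weak_duality:
  assumes u: "u \<in> U_class b c" and \<gamma>: "\<gamma> \<in> radon_on_square b"
    and dom: "dominates b c (marginal1 b \<gamma>) mp" "dominates b c mm (marginal2 b \<gamma>)"
  shows "(\<integral>x. u x \<partial>mp) - (\<integral>x. u x \<partial>mm) \<le> (\<integral>xy. l1norm (fst xy - snd xy) \<partial>\<gamma>)"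
proof -
  have cont: "continuous_on (cube b) u" by (rule U_class_continuous_on[OF u])
  have s: "sets \<gamma> = sets (restrict_space borel (cube b \<times> cube b))" "finite_measure \<gamma>"
    using \<gamma> unfolding radon_on_square_def by auto
  have sp: "space \<gamma> = cube b \<times> cube b"
    using sets_eq_imp_space_eq[OF s(1)] by (simp add: space_restrict_space)
  note int = continuous_on_compact_integrable[OF s compact_Times[OF compact_cube compact_cube]]
  have int_u: "integrable \<gamma> (\<lambda>xy. u (fst xy))" "integrable \<gamma> (\<lambda>xy. u (snd xy))"
    by (auto intro!: int continuous_on_compose2[OF cont] continuous_intros)
  have "(\<integral>x. u x \<partial>mp) - (\<integral>x. u x \<partial>mm) \<le> (\<integral>xy. u (fst xy) \<partial>\<gamma>) - (\<integral>xy. u (snd xy) \<partial>\<gamma>)"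
    using dom u integral_marginal1[OF \<gamma> cont] integral_marginal2[OF \<gamma> cont]
    unfolding dominates_def by (intro diff_mono) auto
  also have "\<dots> = (\<integral>xy. u (fst xy) - u (snd xy) \<partial>\<gamma>)"
    using int_u by simp
  also have "\<dots> \<le> (\<integral>xy. l1norm (fst xy - snd xy) \<partial>\<gamma>)"
  proof (rule integral_mono)
    show "integrable \<gamma> (\<lambda>xy. l1norm (fst xy - snd xy))"
      by (intro int continuous_intros)
    fix xy assume "xy \<in> space \<gamma>"
    then have "\<bar>u (fst xy) - u (snd xy)\<bar> \<le> l1norm (fst xy - snd xy)"
      using u by (auto simp: sp U_class_def)
    then show "u (fst xy) - u (snd xy) \<le> l1norm (fst xy - snd xy)" by simp
  qed (use int_u in auto)
  finally show ?thesis .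
qed

text \<open>\<open>h\<close> may be arbitrary, because its composition with \<open>T\<close> is a
  finite combination of indicators of the fibres of \<open>T\<close>.\<close>

lemma integral_finite_range:
  fixes h :: "'b::t2_space \<Rightarrow> real" and T :: "'a \<Rightarrow> 'b"
  assumes "finite_measure M" "T \<in> borel_measurable M" "finite (T ` space M)"
  shows "integrable M (\<lambda>x. h (T x))"
    and "(\<integral>x. h (T x) \<partial>M) = (\<Sum>k\<in>T ` space M. measure M (T -` {k} \<inter> space M) * h k)"
proof -
  interpret finite_measure M by fact
  have meas: "T -` {k} \<inter> space M \<in> sets M" for k
    using assms(2) by (auto intro: measurable_sets)
  have eq: "h (T x) = (\<Sum>k\<in>T ` space M. indicator (T -` {k} \<inter> space M) x * h k)"
    if "x \<in> space M" for x
  proof -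
    have "(\<Sum>k\<in>T ` space M. indicator (T -` {k} \<inter> space M) x * h k)
        = (\<Sum>k\<in>T ` space M. if k = T x then h k else 0)"
      using that by (intro sum.cong) (auto simp: indicator_def)
    then show ?thesis using that assms(3) by simp
  qed
  have int: "integrable M (\<lambda>x. \<Sum>k\<in>T ` space M. indicator (T -` {k} \<inter> space M) x * h k)"
    using meas by (intro Bochner_Integration.integrable_sum integrable_mult_left)
      (auto simp: integrable_indicator_iff emeasure_eq_measure)
  show "integrable M (\<lambda>x. h (T x))"
    using int by (subst Bochner_Integration.integrable_cong[OF refl eq])
  have "(\<integral>x. h (T x) \<partial>M) = (\<integral>x. (\<Sum>k\<in>T ` space M. indicator (T -` {k} \<inter> space M) x * h k) \<partial>M)"
    by (rule Bochner_Integration.integral_cong[OF refl eq])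
  also have "\<dots> = (\<Sum>k\<in>T ` space M. measure M (T -` {k} \<inter> space M) * h k)"
    using meas by (subst Bochner_Integration.integral_sum)
      (auto simp: integrable_indicator_iff emeasure_eq_measure intro!: integrable_mult_left sum.cong)
  finally show "(\<integral>x. h (T x) \<partial>M) = (\<Sum>k\<in>T ` space M. measure M (T -` {k} \<inter> space M) * h k)" .
qed

text \<open>The coupling is carried by the graph of a map, so its first marginal is
  \<open>mp\<close> itself and the work lies in the second marginal and the cost.\<close>

lemma near_optimal_coupling:
  fixes mp mm :: "(real^'n) measure"
  assumes mp: "finite_measure mp" "sets mp = sets (restrict_space borel (cube b))"
    and mm: "finite_measure mm" "sets mm = sets (restrict_space borel (cube b))"
    and c: "c \<in> cube b"
    and V: "\<And>u. u \<in> U_class b c \<Longrightarrow> (\<integral>x. u x \<partial>mp) - (\<integral>x. u x \<partial>mm) \<le> V"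
    and e: "0 < e"
  shows "\<exists>\<gamma>\<in>radon_on_square b. dominates b c (marginal1 b \<gamma>) mp
      \<and> dominates b c mm (marginal2 b \<gamma>)
      \<and> (\<integral>xy. l1norm (fst xy - snd xy) \<partial>\<gamma>) \<le> V + e"
proof -

  \<comment> \<open>Rounding to a grid and choice of the weights\<close>
  interpret mp: finite_measure mp by fact
  have sp: "space mp = cube b" "space mm = cube b"
    using sets_eq_imp_space_eq[OF mp(2)] sets_eq_imp_space_eq[OF mm(2)]
    by (simp_all add: space_restrict_space)
  define M where "M = measure mp (space mp)"
  have M: "0 \<le> M" unfolding M_def by simp
  \<comment> \<open>Rounding costs \<open>d * M\<close> twice, once when \<open>u x\<close> is
    replaced by \<open>u (T x)\<close> and once when \<open>x\<close> is moved to
    \<open>T x\<close>; the remaining \<open>d\<close> makes the bound by \<open>V'\<close>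
    strict.\<close>
  define d where "d = e / (2 * M + 1)"
  have d: "0 < d" "d * (2 * M + 1) = e" using M e by (auto simp: d_def)
  obtain T :: "real^'n \<Rightarrow> real^'n" where T: "T \<in> borel_measurable borel" "finite (T ` cube b)"
    "\<And>x. x \<in> cube b \<Longrightarrow> T x \<in> cube b" "\<And>x. x \<in> cube b \<Longrightarrow> l1norm (x - T x) \<le> d"
    using cube_rounding[OF d(1), of b] by blast
  have Tm: "T \<in> borel_measurable mp"
    using measurable_restrict_space1[OF T(1), of "cube b"] measurable_cong_sets[OF mp(2) refl]
    by blast
  have Tfin: "finite (T ` space mp)" using T(2) by (simp add: sp)
  define a where "a k = measure mp (T -` {k} \<inter> space mp)" for k
  \<comment> \<open>Grid points of mass 0 are dropped since the barycentres divide by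
    \<open>a k\<close>; sums weighted by \<open>a\<close> do not change.\<close>
  define K where "K = {k \<in> T ` cube b. 0 < a k}"
  have K: "finite K" "K \<subseteq> cube b" unfolding K_def using T by auto
  have int_T: "(\<integral>x. h (T x) \<partial>mp) = (\<Sum>k\<in>K. a k * h k)" for h :: "real^'n \<Rightarrow> real"
  proof -
    have "(\<integral>x. h (T x) \<partial>mp) = (\<Sum>k\<in>T ` space mp. a k * h k)"
      unfolding a_def by (rule integral_finite_range(2)[OF mp(1) Tm Tfin])
    also have "\<dots> = (\<Sum>k\<in>K. a k * h k)"
      using Tfin by (intro sum.mono_neutral_right)
        (auto simp: K_def sp a_def zero_less_measure_iff)
    finally show ?thesis .
  qed
  note int_hT = integral_finite_range(1)[OF mp(1) Tm Tfin]
  have int_U: "integrable mp u" "integrable mm u" if "u \<in> U_class b c" for u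
    using continuous_on_compact_integrable[OF mp(2,1) compact_cube U_class_continuous_on[OF that]]
      continuous_on_compact_integrable[OF mm(2,1) compact_cube U_class_continuous_on[OF that]]
    by auto
  define V' where "V' = V + d * (M + 1)"
  have V': "(\<Sum>k\<in>K. a k * u k) - (\<integral>y. u y \<partial>mm) < V'" if u: "u \<in> U_class b c" for u
  proof -
    have "(\<Sum>k\<in>K. a k * u k) = (\<integral>x. u (T x) \<partial>mp)" by (rule int_T[symmetric])
    also have "\<dots> \<le> (\<integral>x. u x + d \<partial>mp)"
    proof (rule integral_mono)
      fix x assume "x \<in> space mp"
      then have x: "x \<in> cube b" by (simp add: sp)
      have "\<bar>u x - u (T x)\<bar> \<le> l1norm (x - T x)"
        using u x T(3)[OF x] by (auto simp: U_class_def)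
      then show "u (T x) \<le> u x + d" using T(4)[OF x] by linarith
    qed (use int_hT int_U[OF u] in auto)
    also have "\<dots> = (\<integral>x. u x \<partial>mp) + d * M"
      using int_U[OF u] by (simp add: M_def)
    finally show ?thesis using V[OF u] d(1) by (simp add: V'_def algebra_simps)
  qed
  obtain w where w: "\<And>k. k \<in> K \<Longrightarrow> w k \<in> borel_measurable mm"
    "\<And>k y. k \<in> K \<Longrightarrow> y \<in> cube b \<Longrightarrow> 0 \<le> w k y"
    "\<And>k. k \<in> K \<Longrightarrow> (\<integral>y. w k y \<partial>mm) \<le> a k"
    "\<And>y. y \<in> cube b \<Longrightarrow> (\<Sum>k\<in>K. w k y) \<le> 1"
    "(\<Sum>k\<in>K. l1norm (a k *\<^sub>R (k - c) - (\<integral>y. w k y *\<^sub>R (y - c) \<partial>mm))) \<le> V'"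
    using transport_weights_exist[OF mm c K(1), of a V'] V' K_def by blast
  have w1: "w k y \<le> 1" if "k \<in> K" "y \<in> cube b" for k y
    using member_le_sum[of k K "\<lambda>k. w k y"] that K(1) w(2) w(4)[OF that(2)] by fastforce
  define z where "z k = c + (1 / a k) *\<^sub>R (\<integral>y. w k y *\<^sub>R (y - c) \<partial>mm)" for k
  have a_pos: "0 < a k" if "k \<in> K" for k using that by (simp add: K_def)
  have id_m: "(\<lambda>y. y) \<in> borel_measurable mm"
    by (rule continuous_on_measurable_cube[OF mm(2)]) auto
  have jensen: "z k \<in> cube b \<and> a k * g (z k) \<le> (\<integral>y. w k y * g y \<partial>mm)"
    if k: "k \<in> K" and g: "g \<in> U_class b c" for k g
    unfolding z_def
  proof (rule weighted_jensen[OF mm(1) sp(2) id_m compact_cube convex_cube c])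
    show "convex_on (cube b) g" "g c = 0" using g by (auto simp: U_class_def)
    show "continuous_on (cube b) g" by (rule U_class_continuous_on[OF g])
    then show "g \<in> borel_measurable mm" by (rule continuous_on_measurable_cube[OF mm(2)])
  qed (use k w w1 a_pos in auto)
  \<comment> \<open>Any member of the class gives access to the first half of \<open>jensen\<close>,
    which does not involve \<open>g\<close>.\<close>
  have zero_U: "(\<lambda>_. 0) \<in> U_class b c"
    using Max_affine_in_U_class[of "{}" c b] c by simp
  \<comment> \<open>The value \<open>c\<close> off \<open>K\<close> is taken only on a null set of
    \<open>x\<close>, but it keeps the map inside the cube everywhere.\<close>
  define Z where "Z k = (if k \<in> K then z k else c)" for k
  have Z: "Z k \<in> cube b" for k using jensen[OF _ zero_U] c by (auto simp: Z_def)
  have ZTm: "(\<lambda>x. Z (T x)) \<in> borel_measurable mp"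
    using borel_measurable_simple_function[OF simple_function_compose[OF
          simple_function_borel_measurable[OF Tm Tfin], of Z]]
    by (simp add: comp_def)
  have idp: "(\<lambda>x. x) \<in> borel_measurable mp"
    by (rule continuous_on_measurable_cube[OF mp(2)]) auto

  \<comment> \<open>The coupling and its marginals\<close>
  define \<phi> where "\<phi> x = (x, Z (T x))" for x
  have \<phi>: "\<phi> \<in> measurable mp (restrict_space borel (cube b \<times> cube b))"
    unfolding \<phi>_def using Z
    by (intro measurable_restrict_space2 borel_measurable_Pair idp ZTm) (auto simp: sp)
  define \<gamma> where "\<gamma> = distr mp (restrict_space borel (cube b \<times> cube b)) \<phi>"
  have \<gamma>: "\<gamma> \<in> radon_on_square b"
    unfolding radon_on_square_def \<gamma>_def using mp.finite_measure_distr[OF \<phi>] by simp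
  have int_\<gamma>: "(\<integral>xy. h xy \<partial>\<gamma>) = (\<integral>x. h (\<phi> x) \<partial>mp)"
    if "continuous_on (cube b \<times> cube b) h" for h :: "_ \<Rightarrow> real"
    unfolding \<gamma>_def by (rule integral_distr[OF \<phi> borel_measurable_continuous_on_restrict[OF that]])
  have dom1: "dominates b c (marginal1 b \<gamma>) mp"
    unfolding dominates_def
  proof
    fix g assume g: "g \<in> U_class b c"
    note cont = U_class_continuous_on[OF g]
    have "continuous_on (cube b \<times> cube b) (\<lambda>xy. g (fst xy))"
      by (auto intro!: continuous_on_compose2[OF cont] continuous_intros)
    from int_\<gamma>[OF this] show "(\<integral>x. g x \<partial>mp) \<le> (\<integral>x. g x \<partial>marginal1 b \<gamma>)"
      by (simp add: integral_marginal1[OF \<gamma> cont] \<phi>_def)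
  qed
  have dom2: "dominates b c mm (marginal2 b \<gamma>)"
    unfolding dominates_def
  proof
    fix g assume g: "g \<in> U_class b c"
    note cont = U_class_continuous_on[OF g]
    have "continuous_on (cube b \<times> cube b) (\<lambda>xy. g (snd xy))"
      by (auto intro!: continuous_on_compose2[OF cont] continuous_intros)
    from int_\<gamma>[OF this] have "(\<integral>x. g x \<partial>marginal2 b \<gamma>) = (\<integral>x. g (Z (T x)) \<partial>mp)"
      by (simp add: integral_marginal2[OF \<gamma> cont] \<phi>_def)
    also have "\<dots> = (\<Sum>k\<in>K. a k * g (z k))"
      using int_T[of "\<lambda>k. g (Z k)"] by (simp add: Z_def)
    also have "\<dots> \<le> (\<Sum>k\<in>K. \<integral>y. w k y * g y \<partial>mm)"
      using jensen[OF _ g] by (intro sum_mono) auto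
    also have "\<dots> = (\<integral>y. (\<Sum>k\<in>K. w k y * g y) \<partial>mm)"
    proof (rule Bochner_Integration.integral_sum[symmetric])
      fix k assume k: "k \<in> K"
      show "integrable mm (\<lambda>y. w k y * g y)"
      proof (rule Bochner_Integration.integrable_bound[OF int_U(2)[OF g]])
        show "(\<lambda>y. w k y * g y) \<in> borel_measurable mm"
          using w(1)[OF k] continuous_on_measurable_cube[OF mm(2) cont]
          by (rule borel_measurable_times)
        show "AE y in mm. norm (w k y * g y) \<le> norm (g y)"
        proof (rule AE_I2)
          fix y assume "y \<in> space mm"
          then have "\<bar>w k y\<bar> * \<bar>g y\<bar> \<le> 1 * \<bar>g y\<bar>"
            using w(2)[OF k] w1[OF k] by (intro mult_right_mono) (auto simp: sp)
          then show "norm (w k y * g y) \<le> norm (g y)" by (simp add: abs_mult)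
        qed
      qed
    qed
    \<comment> \<open>As \<open>g\<close> is nonnegative, the part of \<open>mm\<close> that no
      piece uses only enlarges the right side.\<close>
    also have "\<dots> \<le> (\<integral>y. g y \<partial>mm)"
    proof (rule integral_mono'[OF int_U(2)[OF g]])
      fix y assume "y \<in> space mm"
      then have y: "y \<in> cube b" and gy: "0 \<le> g y" using g by (auto simp: sp U_class_def)
      show "(\<Sum>k\<in>K. w k y * g y) \<le> g y"
        using mult_right_mono[OF w(4)[OF y] gy] by (simp add: sum_distrib_right)
      show "0 \<le> g y" by (rule gy)
    qed
    finally show "(\<integral>x. g x \<partial>marginal2 b \<gamma>) \<le> (\<integral>x. g x \<partial>mm)" .
  qed

  \<comment> \<open>The cost of the coupling\<close>
  have "continuous_on (cube b \<times> cube b) (\<lambda>xy :: (real^'n) \<times> (real^'n). l1norm (fst xy - snd xy))"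
    by (intro continuous_intros)
  from int_\<gamma>[OF this]
  have "(\<integral>xy. l1norm (fst xy - snd xy) \<partial>\<gamma>) = (\<integral>x. l1norm (x - Z (T x)) \<partial>mp)"
    by (simp add: \<phi>_def)
  \<comment> \<open>Triangle inequality through \<open>T x\<close>. Integrability is asked of the
    dominating integrand only, which takes finitely many values.\<close>
  also have "\<dots> \<le> (\<integral>x. d + l1norm (T x - Z (T x)) \<partial>mp)"
  proof (rule integral_mono')
    show "integrable mp (\<lambda>x. d + l1norm (T x - Z (T x)))"
      using int_hT[of "\<lambda>k. d + l1norm (k - Z k)"] .
    fix x assume "x \<in> space mp"
    then show "l1norm (x - Z (T x)) \<le> d + l1norm (T x - Z (T x))"
      using l1norm_triangle[of "x - T x" "T x - Z (T x)"] T(4)[of x] by (simp add: sp)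
    show "0 \<le> d + l1norm (T x - Z (T x))" using d(1) l1norm_nonneg[of "T x - Z (T x)"] by simp
  qed
  also have "\<dots> = d * M + (\<integral>x. l1norm (T x - Z (T x)) \<partial>mp)"
    using int_hT[of "\<lambda>k. l1norm (k - Z k)"] by (simp add: M_def)
  also have "(\<integral>x. l1norm (T x - Z (T x)) \<partial>mp)
      = (\<Sum>k\<in>K. l1norm (a k *\<^sub>R (k - c) - (\<integral>y. w k y *\<^sub>R (y - c) \<partial>mm)))"
    unfolding int_T[of "\<lambda>k. l1norm (k - Z k)"]
  proof (rule sum.cong)
    fix k assume k: "k \<in> K"
    have "a k *\<^sub>R (k - z k) = a k *\<^sub>R (k - c) - (\<integral>y. w k y *\<^sub>R (y - c) \<partial>mm)"
      using a_pos[OF k] unfolding z_def by (simp add: scaleR_right_diff_distrib scaleR_add_right)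
    then show "a k * l1norm (k - Z k)
        = l1norm (a k *\<^sub>R (k - c) - (\<integral>y. w k y *\<^sub>R (y - c) \<partial>mm))"
      using a_pos[OF k] k l1norm_scaleR[of "a k" "k - z k"] by (simp add: Z_def)
  qed simp
  also have "d * M + \<dots> \<le> d * M + V'" using w(5) by simp
  also have "\<dots> = V + e" using d(2) by (simp add: V'_def algebra_simps)
  finally show ?thesis using \<gamma> dom1 dom2 by blast
qed

text \<open>Weak duality bounds the supremum by the infimum; couplings whose cost exceeds the
  supremum by at most an arbitrary \<open>e > 0\<close> give the reverse.\<close>

theorem theorem1:
  fixes b :: real and c :: "real^'n" and f :: "real^'n \<Rightarrow> real"
    and gradf :: "real^'n \<Rightarrow> real^'n"
    and p :: "real^'n \<Rightarrow> real^'n" and Dp :: "real^'n \<Rightarrow> real^'n \<Rightarrow> real^'n"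
    and mp mm :: "(real^'n) measure"
  assumes b_pos: "b > 0"
    and c_in: "c \<in> cube b"
    and f_nonneg: "\<forall>x\<in>cube b. 0 \<le> f x"
    and f_int: "integrable (lebesgue_on (cube b)) f"
    and f_prob: "(\<integral>x. f x \<partial>lebesgue_on (cube b)) = 1"
    and f_deriv: "\<forall>x\<in>cube b. (f has_derivative (\<lambda>v. gradf x \<bullet> v)) (at x within cube b)"
    and f_C1: "continuous_on (cube b) gradf"
    and p_maps: "\<forall>x\<in>cube b. p x \<in> cube b"
    and p_fix: "p c = c"
    and p_deriv: "\<forall>x\<in>cube b. (p has_derivative Dp x) (at x within cube b)"
    and mu_welldef: "integrable (lebesgue_on (cube b))
           (\<lambda>x. gradf x \<bullet> (x - p x) + (real CARD('n) + 1 - divergence Dp x) * f x)"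
    and jordan: "jordan_decomposition (cube b) (mu_set b c f gradf p Dp) mp mm"
  shows "(SUP u\<in>U_class b c. (\<integral>x. u x \<partial>mp) - (\<integral>x. u x \<partial>mm))
       = (INF \<gamma>\<in>{\<gamma>\<in>radon_on_square b. dominates b c (marginal1 b \<gamma>) mp
                                       \<and> dominates b c mm (marginal2 b \<gamma>)}.
            (\<integral>xy. l1norm (fst xy - snd xy) \<partial>\<gamma>))"
proof -
  have mp: "finite_measure mp" "sets mp = sets (restrict_space borel (cube b))"
    and mm: "finite_measure mm" "sets mm = sets (restrict_space borel (cube b))"
    using jordan unfolding jordan_decomposition_def by auto
  let ?J = "\<lambda>u. (\<integral>x. u x \<partial>mp) - (\<integral>x. u x \<partial>mm)"
  let ?C = "\<lambda>\<gamma>. (\<integral>xy. l1norm (fst xy - snd xy) \<partial>\<gamma>)"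
  let ?G = "{\<gamma>\<in>radon_on_square b. dominates b c (marginal1 b \<gamma>) mp
                                 \<and> dominates b c mm (marginal2 b \<gamma>)}"
  \<comment> \<open>\<open>SUP\<close> and \<open>INF\<close> are taken in the reals, so
    nonemptiness and bounds have to be settled for both.\<close>
  have neU: "U_class b c \<noteq> {}"
    using Max_affine_in_U_class[of "{}" c b] c_in by auto
  have spm: "space mp = cube b" "space mm = cube b"
    using sets_eq_imp_space_eq[OF mp(2)] sets_eq_imp_space_eq[OF mm(2)]
    by (simp_all add: space_restrict_space)
  \<comment> \<open>The Lipschitz condition and \<open>u c = 0\<close> bound \<open>u\<close> by the
    l1 distance to \<open>c\<close>, uniformly over the class.\<close>
  have bddU: "bdd_above (?J ` U_class b c)"
  proof (rule bdd_aboveI2)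
    fix u assume u: "u \<in> U_class b c"
    have "0 \<le> (\<integral>x. u x \<partial>mm)"
      using u by (intro Bochner_Integration.integral_nonneg) (auto simp: spm U_class_def)
    moreover have "(\<integral>x. u x \<partial>mp) \<le> (\<integral>x. l1norm (x - c) \<partial>mp)"
    proof (rule integral_mono')
      show "integrable mp (\<lambda>x. l1norm (x - c))"
        by (intro continuous_on_compact_integrable[OF mp(2,1) compact_cube] continuous_intros)
      fix x assume "x \<in> space mp"
      then have x: "x \<in> cube b" by (simp add: spm)
      have "\<bar>u x - u c\<bar> \<le> l1norm (x - c)" "u c = 0"
        using u x c_in unfolding U_class_def by blast+
      then show "u x \<le> l1norm (x - c)" by simp
    qed (rule l1norm_nonneg)
    ultimately show "?J u \<le> (\<integral>x. l1norm (x - c) \<partial>mp)" by simp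
  qed
  \<comment> \<open>The bound \<open>V\<close> is the supremum itself. The case \<open>e = 1\<close>
    also shows that the set of admissible couplings is nonempty.\<close>
  have coupling: "\<exists>\<gamma>\<in>?G. ?C \<gamma> \<le> (SUP u\<in>U_class b c. ?J u) + e" if "0 < e" for e
    using near_optimal_coupling[OF mp mm c_in cSUP_upper[OF _ bddU] that] by blast
  have bddG: "bdd_below (?C ` ?G)"
    by (rule bdd_belowI2[of _ 0]) (auto intro!: Bochner_Integration.integral_nonneg l1norm_nonneg)
  show ?thesis
  proof (rule antisym)
    show "(SUP u\<in>U_class b c. ?J u) \<le> (INF \<gamma>\<in>?G. ?C \<gamma>)"
      using coupling[of 1] weak_duality by (intro cSUP_least cINF_greatest neU) fastforce+
    show "(INF \<gamma>\<in>?G. ?C \<gamma>) \<le> (SUP u\<in>U_class b c. ?J u)"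
    proof (rule field_le_epsilon)
      fix e :: real assume "0 < e"
      then obtain \<gamma> where "\<gamma> \<in> ?G" "?C \<gamma> \<le> (SUP u\<in>U_class b c. ?J u) + e"
        using coupling by blast
      then show "(INF \<gamma>\<in>?G. ?C \<gamma>) \<le> (SUP u\<in>U_class b c. ?J u) + e"
        by (rule cINF_lower2[OF bddG])
    qed
  qed
qed

end
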